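(* Let $a \geq 3$ be a real number. Then for every $n \in \mathbb{N}$ with $a^2 - 2 \leq n \leq 3a^2 - 16$, $$M_{\frac{1}{a}}(n) \leq \frac{1}{2}(a^2-2)(a^2-1).$$
   Context: A set of lines through the origin in $\mathbb{R}^n$ is called equiangular if the angle between each pair of distinct lines is the same constant $\theta$, called the common angle. For $\alpha \in [0,1)$, $M_{\alpha}(n)$ denotes the maximum cardinality of a set of equiangular lines in $\mathbb{R}^n$ with common angle $\arccos \alpha$; equivalently, the maximum number of unit vectors $x_1,\dots,x_N \in \mathbb{R}^n$ with $|\langle x_i,x_j\rangle| = \alpha$ for all $i \neq j$. *)

theory Defs
  imports "HOL-Analysis.Analysis"
begin

definition line_through_origin :: "'a::euclidean_space set \<Rightarrow> bool" where
  "line_through_origin L \<longleftrightarrow> subspace L \<and> dim L = 1"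

text \<open>
  The angle between two lines is the non-obtuse angle between spanning vectors, hence the absolute
  value. For a pair of lines the value of the arccosine does not depend on the nonzero vectors
  chosen, so the universal quantifiers determine exactly one \<open>\<theta>\<close>.
\<close>

definition lines_at_angle :: "real \<Rightarrow> 'a::euclidean_space set \<Rightarrow> 'a set \<Rightarrow> bool" where
  "lines_at_angle \<theta> K L \<longleftrightarrow>
     (\<forall>x\<in>K - {0}. \<forall>y\<in>L - {0}. arccos (\<bar>x \<bullet> y\<bar> / (norm x * norm y)) = \<theta>)"

text \<open>
  For at most one line the angle condition is vacuous.
\<close>

definition equiangular_lines :: "real \<Rightarrow> 'a::euclidean_space set set \<Rightarrow> bool" where
  "equiangular_lines \<theta> \<L> \<longleftrightarrow>
     (\<forall>L\<in>\<L>. line_through_origin L) \<and> pairwise (lines_at_angle \<theta>) \<L>"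

text \<open>
  The dimension \<open>n\<close> is \<open>CARD('n)\<close>. The supremum is taken in \<open>enat\<close>, with infinite
  families counted as \<open>\<infinity>\<close>, so that an upper bound on \<open>M\<close> is an upper bound on every family
  (infinite ones included); a finite supremum in \<open>enat\<close> is attained, i.e. is a maximum.
\<close>

definition M :: "real \<Rightarrow> 'n::finite itself \<Rightarrow> enat" where
  "M \<alpha> (_ :: 'n itself) =
     (SUP \<L> \<in> {\<L> :: (real ^ 'n) set set. equiangular_lines (arccos \<alpha>) \<L>}.
        if finite \<L> then enat (card \<L>) else \<infinity>)"

end

theory Submission
  imports Defs
begin

text \<open>
  Choose a unit vector on each of the \<open>N\<close> lines, fix one of them, \<open>x\<close>, and flip signs so that all
  other vectors have inner product \<open>1 / a\<close> with \<open>x\<close>. The orthogonal projections of the others to the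
  hyperplane \<open>x\<^sup>\<bottom>\<close>, rescaled to norm 1, form a spherical two-distance set \<open>Y\<close> of \<open>N - 1\<close> points in
  dimension \<open>n - 1\<close> with inner products \<open>1 / (a + 1)\<close> and \<open>- 1 / (a - 1)\<close>.

  The odd cubic \<open>q(t) = ((a\<^sup>2 - 1)\<^sup>2 t\<^sup>3 - (a\<^sup>2 + 3) t) / 2\<close> equals \<open>- 1\<close> at both inner products, and
  \<open>q(1) = (a\<^sup>2 - 2) (a\<^sup>2 - 1) / 2 - 2\<close>. In dimension \<open>m = n - 1\<close> the cubic Gegenbauer polynomial is
  proportional to \<open>(m + 2) t\<^sup>3 - 3 t\<close>, so \<open>q\<close> is a positive multiple of it plus a multiple of \<open>t\<close>,
  the latter being nonnegative precisely when \<open>(a\<^sup>2 + 3) (n + 1) \<le> 3 (a\<^sup>2 - 1)\<^sup>2\<close>; this follows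
  from \<open>n \<le> 3 a\<^sup>2 - 16\<close>. Both kernels are positive semidefinite on the unit sphere of \<open>x\<^sup>\<bottom>\<close> (lemma
  \<open>cubic_gram_sum_ge\<close> for the cubic one), so \<open>q\<close> summed over all ordered pairs of points of \<open>Y\<close> is
  nonnegative. The sum is \<open>(N - 1) q(1) - (N - 1) (N - 2)\<close>, so if \<open>N \<ge> 2\<close> then
  \<open>N - 2 \<le> q(1)\<close> (lemma \<open>two_distance_set_bound\<close>), which is the claim.
\<close>

section \<open>Positivity of the cubic Gegenbauer kernel\<close>

lemma orthonormal_parseval:
  fixes E :: "'a::euclidean_space set"
  assumes "finite E" "pairwise orthogonal E" "\<And>e. e \<in> E \<Longrightarrow> norm e = 1" "y \<in> span E"
  shows "(\<Sum>e\<in>E. (y \<bullet> e) * (z \<bullet> e)) = y \<bullet> z"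
proof -
  have "y \<bullet> z = (\<Sum>e\<in>E. (y \<bullet> e) *\<^sub>R e) \<bullet> z"
    using orthonormal_basis_expand[OF assms(2,3,4,1)] by simp
  also have "\<dots> = (\<Sum>e\<in>E. (y \<bullet> e) * (z \<bullet> e))"
    by (simp add: inner_sum_left inner_commute[of z])
  finally show ?thesis ..
qed

text \<open>
  The Gegenbauer polynomial of degree 3 in dimension \<open>m = dim S\<close> is proportional to
  \<open>(m + 2) t\<^sup>3 - 3 t\<close>. In coordinates, with \<open>v = \<Sum>\<^sub>i f i\<close>, the inequality says that the symmetric
  tensor \<open>T = \<Sum>\<^sub>i f i \<otimes> f i \<otimes> f i\<close> has at least the norm of its non-harmonic part \<open>R / (m + 2)\<close>,
  where \<open>R\<close> is the sum of the three tensors obtained by placing \<open>v\<close> in one slot and the identity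
  in the other two.
\<close>

lemma cubic_gram_sum_ge:
  fixes f :: "'i \<Rightarrow> 'a::euclidean_space"
  assumes S: "subspace S" and f_S: "\<And>i. i \<in> I \<Longrightarrow> f i \<in> S"
    and f_unit: "\<And>i. i \<in> I \<Longrightarrow> norm (f i) = 1"
  shows "3 * (\<Sum>i\<in>I. \<Sum>j\<in>I. f i \<bullet> f j)
           \<le> (real (dim S) + 2) * (\<Sum>i\<in>I. \<Sum>j\<in>I. (f i \<bullet> f j) ^ 3)"
proof -
  obtain E where E: "E \<subseteq> S" "pairwise orthogonal E" "\<And>e. e \<in> E \<Longrightarrow> norm e = 1"
      "independent E" "card E = dim S" "span E = S"
    using orthonormal_basis_subspace[OF S] by metis
  have fin: "finite E"
    using E(4) by (rule independent_imp_finite)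
  have pars: "(\<Sum>e\<in>E. (y \<bullet> e) * (z \<bullet> e)) = y \<bullet> z" if "y \<in> S" for y z
    using orthonormal_parseval[OF fin E(2,3)] that E(6) by blast
  define v where "v = (\<Sum>i\<in>I. f i)"
  have v_S: "v \<in> S"
    unfolding v_def using S f_S by (rule subspace_sum)
  define m where "m = real (dim S) + 2"
  define T where "T b c d = (\<Sum>i\<in>I. (f i \<bullet> b) * (f i \<bullet> c) * (f i \<bullet> d))" for b c d
  define \<delta> where "\<delta> b c = (if b = c then 1 else 0 :: real)" for b c :: 'a
  define R where "R b c d = (v \<bullet> b) * \<delta> c d + (v \<bullet> c) * \<delta> b d + (v \<bullet> d) * \<delta> b c" for b c d
  have unit: "(\<Sum>c\<in>E. (f i \<bullet> c) * (f i \<bullet> c)) = 1" if "i \<in> I" for i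
    using pars[OF f_S[OF that], of "f i"] f_unit[OF that] by (simp add: dot_square_norm)
  have vf: "(\<Sum>i\<in>I. \<Sum>j\<in>I. f i \<bullet> f j) = v \<bullet> v"
    by (subst sum.swap) (simp add: v_def inner_sum_left inner_sum_right)
  have contr: "(\<Sum>b\<in>E. \<Sum>c\<in>E. T b c c * (v \<bullet> b)) = v \<bullet> v"
  proof -
    have "(\<Sum>c\<in>E. T b c c) = v \<bullet> b" for b
    proof -
      have "(\<Sum>c\<in>E. T b c c) = (\<Sum>i\<in>I. \<Sum>c\<in>E. (f i \<bullet> b) * (f i \<bullet> c) * (f i \<bullet> c))"
        unfolding T_def by (rule sum.swap)
      also have "\<dots> = (\<Sum>i\<in>I. (f i \<bullet> b) * (\<Sum>c\<in>E. (f i \<bullet> c) * (f i \<bullet> c)))"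
        by (simp add: sum_distrib_left mult.assoc)
      also have "\<dots> = v \<bullet> b"
        by (simp add: unit v_def inner_sum_left)
      finally show ?thesis .
    qed
    then show ?thesis
      using pars[OF v_S, of v] by (simp flip: sum_distrib_right)
  qed
  have T_sym: "T c b d = T b c d" "T b d c = T b c d" for b c d
    by (simp_all add: T_def mult_ac)
  have TT: "(\<Sum>b\<in>E. \<Sum>c\<in>E. \<Sum>d\<in>E. T b c d * T b c d) = (\<Sum>i\<in>I. \<Sum>j\<in>I. (f i \<bullet> f j) ^ 3)"
  proof -
    define p where "p i = (\<lambda>(b, c, d). (f i \<bullet> b) * (f i \<bullet> c) * (f i \<bullet> d))" for i
    have "(\<Sum>b\<in>E. \<Sum>c\<in>E. \<Sum>d\<in>E. T b c d * T b c d)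
            = (\<Sum>q\<in>E \<times> E \<times> E. (\<Sum>i\<in>I. p i q) * (\<Sum>j\<in>I. p j q))"
      by (simp add: sum.cartesian_product' T_def p_def)
    also have "\<dots> = (\<Sum>q\<in>E \<times> E \<times> E. \<Sum>i\<in>I. \<Sum>j\<in>I. p i q * p j q)"
      by (simp add: sum_product)
    also have "\<dots> = (\<Sum>i\<in>I. \<Sum>q\<in>E \<times> E \<times> E. \<Sum>j\<in>I. p i q * p j q)"
      by (rule sum.swap)
    also have "\<dots> = (\<Sum>i\<in>I. \<Sum>j\<in>I. \<Sum>q\<in>E \<times> E \<times> E. p i q * p j q)"
      by (intro sum.cong refl sum.swap)
    also have "\<dots> = (\<Sum>i\<in>I. \<Sum>j\<in>I. (f i \<bullet> f j) ^ 3)"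
    proof (intro sum.cong refl)
      fix i j assume "i \<in> I" "j \<in> I"
      have "(f i \<bullet> f j) ^ 3 = (\<Sum>e\<in>E. (f i \<bullet> e) * (f j \<bullet> e)) ^ 3"
        using pars[OF f_S[OF \<open>i \<in> I\<close>]] by simp
      also have "\<dots> = (\<Sum>q\<in>E \<times> E \<times> E. p i q * p j q)"
        by (simp add: power3_eq_cube sum_product sum.cartesian_product' p_def
            sum_distrib_left sum_distrib_right mult_ac)
      finally show "(\<Sum>q\<in>E \<times> E \<times> E. p i q * p j q) = (f i \<bullet> f j) ^ 3" ..
    qed
    finally show ?thesis .
  qed
  have TR: "(\<Sum>b\<in>E. \<Sum>c\<in>E. \<Sum>d\<in>E. T b c d * R b c d) = 3 * (v \<bullet> v)"
  proof -
    have 1: "(\<Sum>b\<in>E. \<Sum>c\<in>E. \<Sum>d\<in>E. T b c d * ((v \<bullet> b) * \<delta> c d)) = v \<bullet> v"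
      using fin contr by (simp add: \<delta>_def if_distrib[of "(*) _"] cong: if_cong)
    have "(\<Sum>b\<in>E. \<Sum>c\<in>E. \<Sum>d\<in>E. T b c d * ((v \<bullet> c) * \<delta> b d))
        = (\<Sum>c\<in>E. \<Sum>b\<in>E. \<Sum>d\<in>E. T c b d * ((v \<bullet> c) * \<delta> b d))"
      by (subst sum.swap) (simp add: T_sym)
    then have 2: "(\<Sum>b\<in>E. \<Sum>c\<in>E. \<Sum>d\<in>E. T b c d * ((v \<bullet> c) * \<delta> b d)) = v \<bullet> v"
      using 1 by simp
    have "(\<Sum>b\<in>E. \<Sum>c\<in>E. \<Sum>d\<in>E. T b c d * ((v \<bullet> d) * \<delta> b c))
        = (\<Sum>b\<in>E. \<Sum>d\<in>E. \<Sum>c\<in>E. T b d c * ((v \<bullet> d) * \<delta> b c))"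
      by (rule sum.cong[OF refl], subst sum.swap) (simp add: T_sym)
    then have 3: "(\<Sum>b\<in>E. \<Sum>c\<in>E. \<Sum>d\<in>E. T b c d * ((v \<bullet> d) * \<delta> b c)) = v \<bullet> v"
      using 2 by simp
    show ?thesis
      using 1 2 3 by (simp add: R_def distrib_left sum.distrib)
  qed
  have RR: "(\<Sum>b\<in>E. \<Sum>c\<in>E. \<Sum>d\<in>E. R b c d * R b c d) = 3 * m * (v \<bullet> v)"
  proof -
    have pull: "(\<Sum>d\<in>E. if b = c then g d else 0) = (if b = c then \<Sum>d\<in>E. g d else 0)"
      for b c :: 'a and g :: "'a \<Rightarrow> real"
      by simp
    have "(\<Sum>b\<in>E. \<Sum>c\<in>E. \<Sum>d\<in>E. R b c d * R b c d)
        = 3 * (real (card E) + 2) * (\<Sum>b\<in>E. (v \<bullet> b) * (v \<bullet> b))"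
      using fin
      by (simp add: R_def \<delta>_def algebra_simps sum.distrib if_distrib[of "(*) _"]
          sum_distrib_left pull cong: if_cong)
        (simp add: algebra_simps flip: sum.distrib)
    then show ?thesis
      using pars[OF v_S, of v] E(5) by (simp add: m_def)
  qed
  have "0 \<le> (\<Sum>b\<in>E. \<Sum>c\<in>E. \<Sum>d\<in>E. (m * T b c d - R b c d)\<^sup>2)"
    by (intro sum_nonneg zero_le_power2)
  also have "\<dots> = (\<Sum>b\<in>E. \<Sum>c\<in>E. \<Sum>d\<in>E.
      m\<^sup>2 * (T b c d * T b c d) - 2 * m * (T b c d * R b c d) + R b c d * R b c d)"
    by (intro sum.cong refl) (simp add: power2_eq_square algebra_simps)
  also have "\<dots> = m\<^sup>2 * (\<Sum>b\<in>E. \<Sum>c\<in>E. \<Sum>d\<in>E. T b c d * T b c d)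
      - 2 * m * (\<Sum>b\<in>E. \<Sum>c\<in>E. \<Sum>d\<in>E. T b c d * R b c d)
      + (\<Sum>b\<in>E. \<Sum>c\<in>E. \<Sum>d\<in>E. R b c d * R b c d)"
    by (simp add: sum.distrib sum_subtractf sum_distrib_left)
  also have "\<dots> = m * (m * (\<Sum>i\<in>I. \<Sum>j\<in>I. (f i \<bullet> f j) ^ 3) - 3 * (v \<bullet> v))"
    unfolding TT TR RR by (simp add: power2_eq_square algebra_simps)
  finally have "0 \<le> m * (\<Sum>i\<in>I. \<Sum>j\<in>I. (f i \<bullet> f j) ^ 3) - 3 * (v \<bullet> v)"
    by (simp add: zero_le_mult_iff m_def)
  then show ?thesis
    by (simp add: vf m_def)
qed

section \<open>The two-distance set of projected vectors\<close>

text \<open>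
  The last hypothesis only matters for the empty family.
\<close>

lemma two_distance_set_bound:
  fixes f :: "'i \<Rightarrow> 'a::euclidean_space" and a :: real
  assumes fin: "finite I" and S: "subspace S" and f_S: "\<And>i. i \<in> I \<Longrightarrow> f i \<in> S"
    and f_unit: "\<And>i. i \<in> I \<Longrightarrow> norm (f i) = 1"
    and f_inner: "\<And>i j. i \<in> I \<Longrightarrow> j \<in> I \<Longrightarrow> i \<noteq> j \<Longrightarrow>
                    f i \<bullet> f j = 1 / (a + 1) \<or> f i \<bullet> f j = - 1 / (a - 1)"
    and a: "a > 1" and dim: "(a\<^sup>2 + 3) * (real (dim S) + 2) \<le> 3 * (a\<^sup>2 - 1)\<^sup>2"
    and a': "2 \<le> (a\<^sup>2 - 2) * (a\<^sup>2 - 1)"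
  shows "real (card I) \<le> (a\<^sup>2 - 2) * (a\<^sup>2 - 1) / 2 - 1"
proof (cases "I = {}")
  case True
  then show ?thesis using a' by simp
next
  case False
  define q where "q t = ((a\<^sup>2 - 1)\<^sup>2 * t ^ 3 - (a\<^sup>2 + 3) * t) / 2" for t
  define C where "C = (a\<^sup>2 - 2) * (a\<^sup>2 - 1) / 2 - 1"
  have q_one: "q 1 = C - 1"
    by (simp add: q_def C_def power2_eq_square field_simps)
  \<comment> \<open>Requiring the value \<open>- 1\<close> at both inner products determines the two coefficients of \<open>q\<close>.\<close>
  have q_off: "q t = - 1" if "t = 1 / (a + 1) \<or> t = - 1 / (a - 1)" for t
  proof -
    from that have "(a + 1) * t = 1 \<or> (a - 1) * t = - 1"
      using a by auto
    then show ?thesis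
      unfolding q_def by algebra
  qed
  define s1 where "s1 = (\<Sum>i\<in>I. \<Sum>j\<in>I. f i \<bullet> f j)"
  define s3 where "s3 = (\<Sum>i\<in>I. \<Sum>j\<in>I. (f i \<bullet> f j) ^ 3)"
  define m where "m = real (dim S) + 2"
  have s1_nonneg: "0 \<le> s1"
  proof -
    have "s1 = (\<Sum>i\<in>I. f i) \<bullet> (\<Sum>i\<in>I. f i)"
      unfolding s1_def by (subst sum.swap) (simp add: inner_sum_left inner_sum_right)
    then show ?thesis by simp
  qed
  have s3: "3 * s1 \<le> m * s3"
    unfolding s1_def s3_def m_def by (rule cubic_gram_sum_ge[OF S f_S f_unit])
  have m: "m > 0" by (simp add: m_def)
  have "(a\<^sup>2 + 3) * s1 * m \<le> 3 * (a\<^sup>2 - 1)\<^sup>2 * s1"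
    using mult_right_mono[OF dim s1_nonneg] by (simp add: m_def mult_ac)
  also have "\<dots> \<le> (a\<^sup>2 - 1)\<^sup>2 * s3 * m"
    using mult_left_mono[OF s3, of "(a\<^sup>2 - 1)\<^sup>2"] by (simp add: mult_ac)
  finally have "(a\<^sup>2 + 3) * s1 \<le> (a\<^sup>2 - 1)\<^sup>2 * s3"
    using m by simp
  then have "0 \<le> ((a\<^sup>2 - 1)\<^sup>2 * s3 - (a\<^sup>2 + 3) * s1) / 2"
    by simp
  also have "\<dots> = (\<Sum>i\<in>I. \<Sum>j\<in>I. q (f i \<bullet> f j))"
    by (simp add: q_def s1_def s3_def sum_subtractf sum_distrib_left flip: sum_divide_distrib)
  also have "\<dots> = (\<Sum>i\<in>I. \<Sum>j\<in>I. (if i = j then C else 0) - 1)"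
  proof (intro sum.cong refl)
    fix i j assume ij: "i \<in> I" "j \<in> I"
    show "q (f i \<bullet> f j) = (if i = j then C else 0) - 1"
    proof (cases "i = j")
      case True
      then show ?thesis
        using f_unit[OF ij(1)] q_one by (simp add: dot_square_norm)
    next
      case False
      then show ?thesis
        using q_off[OF f_inner[OF ij False]] by simp
    qed
  qed
  also have "\<dots> = real (card I) * (C - real (card I))"
    using fin by (simp add: sum_subtractf)
  finally show ?thesis
    using False fin by (simp add: zero_le_mult_iff C_def card_gt_0_iff)
qed

section \<open>Equiangular lines\<close>

text \<open>
  The last hypothesis only matters for sets of at most one vector.
\<close>

lemma equiangular_unit_vectors_bound:
  fixes X :: "'a::euclidean_space set" and a :: real
  assumes fin: "finite X" and unit: "\<And>x. x \<in> X \<Longrightarrow> norm x = 1"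
    and angle: "\<And>x y. x \<in> X \<Longrightarrow> y \<in> X \<Longrightarrow> x \<noteq> y \<Longrightarrow> \<bar>x \<bullet> y\<bar> = 1 / a"
    and a: "a > 1" and dim: "(a\<^sup>2 + 3) * (real DIM('a) + 1) \<le> 3 * (a\<^sup>2 - 1)\<^sup>2"
    and a': "2 \<le> (a\<^sup>2 - 2) * (a\<^sup>2 - 1)"
  shows "real (card X) \<le> (a\<^sup>2 - 2) * (a\<^sup>2 - 1) / 2"
proof (cases "X = {}")
  case True
  then show ?thesis using a' by simp
next
  case False
  then obtain x where x: "x \<in> X" by blast
  have xx: "x \<bullet> x = 1"
    using unit[OF x] by (simp add: dot_square_norm)
  define S where "S = {y. x \<bullet> y = 0}"
  have S: "subspace S"
    unfolding S_def by (rule subspace_hyperplane)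
  have "x \<noteq> 0" using xx by auto
  then have dim_S: "dim S = DIM('a) - 1"
    unfolding S_def by (rule dim_hyperplane)
  have a1: "a\<^sup>2 - 1 > 0"
    using a by (simp add: one_less_power)
  define \<sigma> where "\<sigma> y = sgn (x \<bullet> y) * a" for y
  \<comment> \<open>\<open>\<sigma> y *\<^sub>R y\<close> has norm \<open>a\<close> and inner product 1 with \<open>x\<close>, so subtracting \<open>x\<close> projects it to \<open>S\<close>.\<close>
  define f where "f y = (\<sigma> y *\<^sub>R y - x) /\<^sub>R sqrt (a\<^sup>2 - 1)" for y
  have \<sigma>: "\<sigma> y * (x \<bullet> y) = 1" "(\<sigma> y)\<^sup>2 = a\<^sup>2" if "y \<in> X - {x}" for y
  proof -
    have *: "\<bar>x \<bullet> y\<bar> = 1 / a" using angle[of x y] x that by auto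
    then show "\<sigma> y * (x \<bullet> y) = 1"
      using a by (simp add: \<sigma>_def mult.commute mult.left_commute
          flip: abs_sgn)
    show "(\<sigma> y)\<^sup>2 = a\<^sup>2"
      using * a by (auto simp: \<sigma>_def power_mult_distrib sgn_if)
  qed
  have inner_f: "f y \<bullet> f z = (\<sigma> y * \<sigma> z * (y \<bullet> z) - 1) / (a\<^sup>2 - 1)"
    if "y \<in> X - {x}" "z \<in> X - {x}" for y z
  proof -
    have "f y \<bullet> f z = ((\<sigma> y *\<^sub>R y - x) \<bullet> (\<sigma> z *\<^sub>R z - x)) / (sqrt (a\<^sup>2 - 1) * sqrt (a\<^sup>2 - 1))"
      unfolding f_def inner_scaleR_left inner_scaleR_right
      by (simp only: divide_inverse inverse_mult_distrib mult_ac)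
    also have "(\<sigma> y *\<^sub>R y - x) \<bullet> (\<sigma> z *\<^sub>R z - x) = \<sigma> y * \<sigma> z * (y \<bullet> z) - 1"
      using \<sigma>[OF that(1)] \<sigma>[OF that(2)] xx
      by (simp add: inner_diff_left inner_diff_right inner_commute)
    finally show ?thesis using a1 by simp
  qed
  have "real (card (X - {x})) \<le> (a\<^sup>2 - 2) * (a\<^sup>2 - 1) / 2 - 1"
  proof (rule two_distance_set_bound[OF _ S])
    show "finite (X - {x})" using fin by simp
    show "f y \<in> S" if "y \<in> X - {x}" for y
      using \<sigma>[OF that] xx by (simp add: S_def f_def inner_diff_right)
    show "norm (f y) = 1" if y: "y \<in> X - {x}" for y
    proof -
      have "y \<bullet> y = 1" using unit[of y] y by (simp add: dot_square_norm)
      then have "f y \<bullet> f y = 1"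
        using inner_f[OF y y] \<sigma>(2)[OF y] a1 by (simp flip: power2_eq_square)
      then show ?thesis by (simp add: norm_eq_sqrt_inner)
    qed
    show "f y \<bullet> f z = 1 / (a + 1) \<or> f y \<bullet> f z = - 1 / (a - 1)"
      if yz: "y \<in> X - {x}" "z \<in> X - {x}" "y \<noteq> z" for y z
    proof -
      have "(\<sigma> y * \<sigma> z * (y \<bullet> z))\<^sup>2 = a\<^sup>2 * a\<^sup>2 * \<bar>y \<bullet> z\<bar>\<^sup>2"
        using \<sigma>(2)[OF yz(1)] \<sigma>(2)[OF yz(2)] by (simp add: power_mult_distrib)
      also have "\<dots> = a\<^sup>2"
        using angle[of y z] yz a by (simp add: power2_eq_square)
      finally have "\<sigma> y * \<sigma> z * (y \<bullet> z) = a \<or> \<sigma> y * \<sigma> z * (y \<bullet> z) = - a"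
        by (simp add: power2_eq_iff)
      moreover have "(a - 1) / (a\<^sup>2 - 1) = 1 / (a + 1)" "(- a - 1) / (a\<^sup>2 - 1) = - 1 / (a - 1)"
      proof -
        have "a\<^sup>2 - 1 = (a - 1) * (a + 1)"
          by (simp add: power2_eq_square algebra_simps)
        then show "(a - 1) / (a\<^sup>2 - 1) = 1 / (a + 1)" "(- a - 1) / (a\<^sup>2 - 1) = - 1 / (a - 1)"
          using a by (simp_all add: divide_simps)
      qed
      ultimately show ?thesis
        using inner_f[OF yz(1,2)] by metis
    qed
    show "a > 1" "2 \<le> (a\<^sup>2 - 2) * (a\<^sup>2 - 1)" by fact+
    show "(a\<^sup>2 + 3) * (real (dim S) + 2) \<le> 3 * (a\<^sup>2 - 1)\<^sup>2"
      using dim by (simp add: dim_S of_nat_diff add.commute)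
  qed
  moreover have "card X = card (X - {x}) + 1"
    using card.remove[OF fin x] by simp
  ultimately show ?thesis by simp
qed

lemma equiangular_lines_unit_vectors:
  fixes \<L> :: "'a::euclidean_space set set"
  assumes eq: "equiangular_lines (arccos \<alpha>) \<L>" and \<alpha>: "0 \<le> \<alpha>" "\<alpha> < 1"
  obtains X where "bij_betw (\<lambda>x. span {x}) X \<L>" "\<And>x. x \<in> X \<Longrightarrow> norm x = 1"
    "\<And>x y. x \<in> X \<Longrightarrow> y \<in> X \<Longrightarrow> x \<noteq> y \<Longrightarrow> \<bar>x \<bullet> y\<bar> = \<alpha>"
proof -
  have "\<exists>x. norm x = 1 \<and> span {x} = L" if "L \<in> \<L>" for L
  proof -
    have L: "subspace L" "dim L = 1"
      using eq that by (auto simp: equiangular_lines_def line_through_origin_def)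
    obtain B where B: "\<And>x. x \<in> B \<Longrightarrow> norm x = 1" "card B = dim L" "span B = L"
      using orthonormal_basis_subspace[OF L(1)] by metis
    then show ?thesis using L(2) by (metis card_1_singletonE insertI1)
  qed
  then obtain u where u: "\<And>L. L \<in> \<L> \<Longrightarrow> norm (u L) = 1" "\<And>L. L \<in> \<L> \<Longrightarrow> span {u L} = L"
    by metis
  have ang: "\<bar>u K \<bullet> u L\<bar> = \<alpha>" if "K \<in> \<L>" "L \<in> \<L>" "K \<noteq> L" for K L
  proof -
    have "u K \<in> K - {0}" "u L \<in> L - {0}"
      using u[OF that(1)] u[OF that(2)] span_base[of "u K" "{u K}"] span_base[of "u L" "{u L}"]
      by auto
    moreover have "lines_at_angle (arccos \<alpha>) K L"
      using eq that by (simp add: equiangular_lines_def pairwise_def)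
    ultimately have "arccos (\<bar>u K \<bullet> u L\<bar> / (norm (u K) * norm (u L))) = arccos \<alpha>"
      unfolding lines_at_angle_def by blast
    then have "arccos \<bar>u K \<bullet> u L\<bar> = arccos \<alpha>"
      using u(1) that by simp
    moreover have "\<bar>u K \<bullet> u L\<bar> \<le> 1"
      using Cauchy_Schwarz_ineq2[of "u K" "u L"] u(1) that by simp
    ultimately show ?thesis
      using \<alpha> arccos_eq_iff[of "\<bar>u K \<bullet> u L\<bar>" \<alpha>] by simp
  qed
  have "bij_betw (\<lambda>x. span {x}) (u ` \<L>) \<L>"
    by (rule bij_betw_byWitness[where f' = u]) (auto simp: u(2))
  then show ?thesis
    by (rule that) (use u(1) ang in auto)
qed

theorem theorem1p1:
  fixes a :: real
  assumes "a \<ge> 3"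
    and "a\<^sup>2 - 2 \<le> real CARD('n::finite)"
    and "real CARD('n) \<le> 3 * a\<^sup>2 - 16"
  shows "ereal_of_enat (M (1 / a) TYPE('n)) \<le> ereal (1 / 2 * (a\<^sup>2 - 2) * (a\<^sup>2 - 1))"
proof -
  have a2: "a\<^sup>2 \<ge> 9"
    using power_mono[OF assms(1), of 2] by simp
  define B where "B = (a\<^sup>2 - 2) * (a\<^sup>2 - 1) / 2"
  have "7 * 8 \<le> (a\<^sup>2 - 2) * (a\<^sup>2 - 1)"
    using a2 by (intro mult_mono) auto
  then have B: "2 \<le> (a\<^sup>2 - 2) * (a\<^sup>2 - 1)" "0 \<le> B"
    by (simp_all add: B_def)
  have "(a\<^sup>2 + 3) * (real CARD('n) + 1) \<le> (a\<^sup>2 + 3) * (3 * a\<^sup>2 - 15)"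
    using assms(3) a2 by (intro mult_left_mono) auto
  also have "\<dots> \<le> 3 * (a\<^sup>2 - 1)\<^sup>2"
    by (simp add: power2_eq_square algebra_simps)
  finally have dim: "(a\<^sup>2 + 3) * (real DIM(real ^ 'n) + 1) \<le> 3 * (a\<^sup>2 - 1)\<^sup>2"
    by simp
  have finite_bound: "card \<L> \<le> nat \<lfloor>B\<rfloor>"
    if eq: "equiangular_lines (arccos (1 / a)) \<L>" and fin: "finite \<L>" for \<L> :: "(real ^ 'n) set set"
  proof -
    obtain X where X: "bij_betw (\<lambda>x. span {x}) X \<L>" "\<And>x. x \<in> X \<Longrightarrow> norm x = 1"
      "\<And>x y. x \<in> X \<Longrightarrow> y \<in> X \<Longrightarrow> x \<noteq> y \<Longrightarrow> \<bar>x \<bullet> y\<bar> = 1 / a"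
      by (rule equiangular_lines_unit_vectors[OF eq]) (use assms(1) in auto)
    have "finite X"
      using bij_betw_finite[OF X(1)] fin by simp
    then have "real (card X) \<le> B"
      unfolding B_def
      using equiangular_unit_vectors_bound[OF _ X(2,3) _ dim B(1)] assms(1) by simp
    then show ?thesis
      using bij_betw_same_card[OF X(1)] by (simp add: le_nat_floor)
  qed
  have "(if finite \<L> then enat (card \<L>) else \<infinity>) \<le> enat (nat \<lfloor>B\<rfloor>)"
    if eq: "equiangular_lines (arccos (1 / a)) \<L>" for \<L> :: "(real ^ 'n) set set"
  proof -
    have "finite \<L>"
    proof (rule ccontr)
      assume "infinite \<L>"
      then obtain \<K> where \<K>: "\<K> \<subseteq> \<L>" "finite \<K>" "card \<K> = Suc (nat \<lfloor>B\<rfloor>)"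
        by (meson infinite_arbitrarily_large)
      have "equiangular_lines (arccos (1 / a)) \<K>"
        using eq \<K>(1) by (auto simp: equiangular_lines_def intro: pairwise_mono)
      then show False
        using finite_bound[of \<K>] \<K>(2,3) by simp
    qed
    then show ?thesis
      using finite_bound[OF eq] by simp
  qed
  then have "M (1 / a) TYPE('n) \<le> enat (nat \<lfloor>B\<rfloor>)"
    unfolding M_def by (intro SUP_least) auto
  then have "ereal_of_enat (M (1 / a) TYPE('n)) \<le> ereal_of_enat (enat (nat \<lfloor>B\<rfloor>))"
    by (simp only: ereal_of_enat_le_iff)
  also have "\<dots> \<le> ereal B"
    using B(2) by simp
  finally show ?thesis
    by (simp add: B_def)
qed

end
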